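(* Let $f$ be a gauge function such that $x^{-1}f(x)$ is monotonically decreasing on $(0,\infty)$, and let $0\leq s<1$. Then the following are equivalent: (1) $H^f(\mathcal{D}_s)>0$; (2) $H^f(\mathcal{D}_{\leq s})>0$; (3) for every $r\in(s,1]$, it is not the case that $f(x)\leq^* x^r$.
   Context: $2^\omega$ is Cantor space of infinite binary sequences, $2^{<\omega}$ the set of finite binary strings; for $\sigma\in2^{<\omega}$, $[\sigma]=\{x\in2^\omega:\sigma\subseteq x\}$ and $|\sigma|$ is the length of $\sigma$. A gauge function is a continuous non-decreasing $f:\mathbb{R}^+\to\mathbb{R}^+$ with $\lim_{x\to0^+}f(x)=0$. For $A\subseteq2^\omega$, $H^f(A)=\lim_{n\to\infty}\inf\{\sum_i f(2^{-|\sigma_i|}):\bigcup_i[\sigma_i]\supseteq A,\ \forall i\ |\sigma_i|\geq n\}$. For $f,g:\mathbb{R}^+\to\mathbb{R}^+$, $f(x)\leq^* g(x)$ means there is $\delta>0$ with $f(x)\leq g(x)$ for all $x\in(0,\delta)$. $K(\sigma)$ denotes the prefix-free Kolmogorov complexity of $\sigma$ (with respect to a fixed optimal prefix-free machine), and the effective dimension of $x\in2^\omega$ is $dim(x)=\liminf_{n\to\infty}K(x\upharpoonright n)/n$. For $0\le s\le1$, $\mathcal{D}_s=\{x\in2^\omega:dim(x)=s\}$ and $\mathcal{D}_{\leq s}=\{x\in2^\omega:dim(x)\leq s\}$. *)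

theory Defs
  imports "HOL-Analysis.Analysis" "HOL-Library.Extended_Nat"
begin

type_synonym cantor = "nat \<Rightarrow> bool"

definition cyl :: "bool list \<Rightarrow> cantor set" where
  "cyl \<sigma> = {x. \<forall>i<length \<sigma>. x i = \<sigma> ! i}"

definition restr :: "cantor \<Rightarrow> nat \<Rightarrow> bool list" where
  "restr x n = map x [0..<n]"

definition gauge :: "(real \<Rightarrow> real) \<Rightarrow> bool" where
  "gauge f \<longleftrightarrow> continuous_on {0<..} f
     \<and> (\<forall>x y. 0 < x \<longrightarrow> x \<le> y \<longrightarrow> f x \<le> f y)
     \<and> (\<forall>x>0. f x > 0)
     \<and> (f \<longlongrightarrow> 0) (at_right 0)"

text \<open>H^f(A) = lim_n inf { sum_i f(2^-|sigma_i|) : covers by strings of length >= n };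
  the infimum is non-decreasing in n, so the limit is the supremum.\<close>
definition hausdorff :: "(real \<Rightarrow> real) \<Rightarrow> cantor set \<Rightarrow> ennreal" where
  "hausdorff f A = (SUP n. INF C \<in> {C. (\<forall>\<sigma>\<in>C. n \<le> length \<sigma>) \<and> A \<subseteq> (\<Union>\<sigma>\<in>C. cyl \<sigma>)}.
      (\<Sum>\<^sub>\<infinity>\<sigma>\<in>C. ennreal (f (2 powr (- real (length \<sigma>))))))"

definition le_star :: "(real \<Rightarrow> real) \<Rightarrow> (real \<Rightarrow> real) \<Rightarrow> bool" where
  "le_star f g \<longleftrightarrow> (\<exists>\<delta>>0. \<forall>x. 0 < x \<and> x < \<delta> \<longrightarrow> f x \<le> g x)"

datatype recf = Zero | Succ | Proj nat | Comp recf "recf list" | Prim recf recf | Mu recf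

inductive eval :: "recf \<Rightarrow> nat list \<Rightarrow> nat \<Rightarrow> bool" where
  eval_Zero: "eval Zero xs 0"
| eval_Succ: "eval Succ (x # xs) (Suc x)"
| eval_Proj: "i < length xs \<Longrightarrow> eval (Proj i) xs (xs ! i)"
| eval_Comp: "list_all2 (\<lambda>g y. eval g xs y) gs ys \<Longrightarrow> eval f ys z \<Longrightarrow> eval (Comp f gs) xs z"
| eval_Prim0: "eval f xs y \<Longrightarrow> eval (Prim f g) (0 # xs) y"
| eval_PrimS: "eval (Prim f g) (n # xs) r \<Longrightarrow> eval g (r # n # xs) y
     \<Longrightarrow> eval (Prim f g) (Suc n # xs) y"
| eval_Mu: "eval f (n # xs) 0 \<Longrightarrow> (\<forall>m<n. \<exists>k. eval f (m # xs) (Suc k))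
     \<Longrightarrow> eval (Mu f) xs n"

text \<open>Bijective encoding of binary strings by natural numbers.\<close>
primrec enc :: "bool list \<Rightarrow> nat" where
  "enc [] = 0"
| "enc (b # bs) = (if b then 2 else 1) + 2 * enc bs"

type_synonym machine = "bool list \<Rightarrow> bool list option"

definition computable_machine :: "machine \<Rightarrow> bool" where
  "computable_machine M \<longleftrightarrow>
     (\<exists>c. \<forall>p y. M p = Some y \<longleftrightarrow> eval c [enc p] (enc y))"

definition prefix_free_machine :: "machine \<Rightarrow> bool" where
  "prefix_free_machine M \<longleftrightarrow> computable_machine M \<and>
     (\<forall>p q. M p \<noteq> None \<longrightarrow> M q \<noteq> None \<longrightarrow> take (length p) q = p \<longrightarrow> p = q)"

definition KM :: "machine \<Rightarrow> bool list \<Rightarrow> enat" where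
  "KM M \<sigma> = (INF p \<in> {p. M p = Some \<sigma>}. enat (length p))"

definition optimal_machine :: "machine \<Rightarrow> bool" where
  "optimal_machine U \<longleftrightarrow> prefix_free_machine U \<and>
     (\<forall>M. prefix_free_machine M \<longrightarrow> (\<exists>c::nat. \<forall>\<sigma>. KM U \<sigma> \<le> KM M \<sigma> + enat c))"

text \<open>K(sigma) for the fixed optimal machine U (finite for optimal U).\<close>
definition Kc :: "machine \<Rightarrow> bool list \<Rightarrow> real" where
  "Kc U \<sigma> = real (the_enat (KM U \<sigma>))"

definition eff_dim :: "machine \<Rightarrow> cantor \<Rightarrow> ereal" where
  "eff_dim U x = liminf (\<lambda>n. ereal (Kc U (restr x n) / real n))"

definition Dim_eq :: "machine \<Rightarrow> real \<Rightarrow> cantor set" where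
  "Dim_eq U s = {x. eff_dim U x = ereal s}"

definition Dim_le :: "machine \<Rightarrow> real \<Rightarrow> cantor set" where
  "Dim_le U s = {x. eff_dim U x \<le> ereal s}"

end

theory Submission
  imports Defs "HOL-Probability.Probability"
begin

text \<open>
  If \<open>f \<le>\<^sup>* x\<^sup>r\<close> with \<open>r > q > s\<close>, the strings with \<open>K(\<sigma>) \<le> q |\<sigma>|\<close> cover \<open>D\<^sub>\<le>\<^sub>s\<close>,
  and the Kraft inequality bounds the \<open>f\<close>-weight of those of length at least \<open>N\<close> by
  \<open>2\<close> to the power \<open>-(r - q) N\<close>.

  Conversely, suppose that \<open>f(2\<^sup>-\<^sup>n)\<close> is infinitely often at least about \<open>2\<^sup>-\<^sup>r\<^sup>n\<close>, for every \<open>r > s\<close>.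
  Along a sparse sequence of such \<open>n\<^sub>k\<close> with \<open>r\<^sub>k\<close> decreasing to \<open>s\<close>, force the bits of \<open>x\<close> in
  \<open>[m\<^sub>k, n\<^sub>k)\<close> to be zero, where \<open>m\<^sub>k\<close> is about \<open>r\<^sub>k n\<^sub>k\<close>, and leave all others free. The uniform measure on
  these sequences is bounded by a multiple of \<open>f\<close> on cylinders: on the zero blocks because \<open>f\<close> is monotone,
  on the free blocks because \<open>f(x)/x\<close> is. The prefixes of length \<open>n\<^sub>k\<close> compress to about
  \<open>s n\<^sub>k\<close> bits, so the dimension is at most \<open>s\<close>. By Kraft again, the strings \<open>\<sigma>\<close> whose complexity is less than
  their number of free bits minus one have total measure at most \<open>1/2\<close>; what remains has dimension exactly \<open>s\<close>
  and, by the mass distribution principle, positive measure.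
\<close>

section \<open>The Kraft inequality and the mass of covers\<close>

text \<open>Fair coin tossing on Cantor space. It serves twice: for the Kraft inequality, and for
  the mass carried by the free coordinates of a block sequence.\<close>

definition coin :: "cantor measure" where
  "coin = Pi\<^sub>M UNIV (\<lambda>_. measure_pmf (bernoulli_pmf (1/2)))"

interpretation coin: product_prob_space "\<lambda>_. measure_pmf (bernoulli_pmf (1/2))" "UNIV :: nat set"
  by unfold_locales

lemma space_coin [simp]: "space coin = UNIV"
  by (simp add: coin_def space_PiM)

lemma prob_space_coin: "prob_space coin"
  unfolding coin_def by (rule coin.P.prob_space_axioms)

lemma sets_coin_agree:
  assumes "finite J"
  shows "{x. \<forall>i\<in>J. x i = z i} \<in> sets coin"
proof -
  have "{x \<in> space coin. \<forall>i\<in>J. x i = z i} \<in> sets coin"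
  proof (rule sets.sets_Collect_finite_All[OF _ assms])
    fix i assume "i \<in> J"
    have "(\<lambda>x. x i) \<in> measurable coin (measure_pmf (bernoulli_pmf (1/2)))"
      unfolding coin_def by (rule measurable_component_singleton) simp
    from measurable_sets[OF this, of "{z i}"]
    show "{x \<in> space coin. x i = z i} \<in> sets coin"
      by (simp add: vimage_def)
  qed
  then show ?thesis by simp
qed

lemma emeasure_coin_agree:
  assumes "finite J"
  shows "emeasure coin {x. \<forall>i\<in>J. x i = z i} = ennreal ((1/2) ^ card J)"
proof -
  have half: "emeasure (measure_pmf (bernoulli_pmf (1/2))) {b} = ennreal (1/2)" for b
    by (cases b) (simp_all add: emeasure_pmf_single)
  have "emeasure coin {x \<in> space coin. \<forall>i\<in>J. x i \<in> {z i}} = (\<Prod>i\<in>J. ennreal (1/2))"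
    unfolding coin_def
    by (subst coin.emeasure_PiM_Collect) (use assms half in auto)
  also have "\<dots> = ennreal ((1/2) ^ card J)"
    by (simp only: prod_constant) (rule ennreal_power, simp)
  finally show ?thesis by simp
qed

lemma cyl_eq_agree: "cyl \<sigma> = {x. \<forall>i\<in>{..<length \<sigma>}. x i = \<sigma> ! i}"
  by (auto simp: cyl_def)

text \<open>Prefix-incomparable strings have disjoint cylinders, so the summands are the coin
  measures of disjoint subsets of a probability space.\<close>

lemma kraft_finite:
  fixes P :: "bool list set"
  assumes "finite P"
    and pf: "\<And>p q. p \<in> P \<Longrightarrow> q \<in> P \<Longrightarrow> take (length p) q = p \<Longrightarrow> p = q"
  shows "(\<Sum>p\<in>P. (1/2::real) ^ length p) \<le> 1"
proof -
  interpret prob_space coin by (rule prob_space_coin)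
  have disj: "cyl p \<inter> cyl q = {}" if "p \<in> P" "q \<in> P" "p \<noteq> q" for p q
  proof -
    have *: False if "p \<in> P" "q \<in> P" "p \<noteq> q" "x \<in> cyl p" "x \<in> cyl q" "length p \<le> length q" for p q x
    proof -
      have "take (length p) q = p"
        using that by (intro nth_equalityI) (auto simp: cyl_def)
      with pf that show False by blast
    qed
    show ?thesis
      using *[of p q] *[of q p] that by (metis disjoint_iff nle_le)
  qed
  have "(\<Sum>p\<in>P. measure coin (cyl p)) = measure coin (\<Union>p\<in>P. cyl p)"
    by (rule finite_measure_finite_Union[symmetric])
       (use assms disj in \<open>auto simp: cyl_eq_agree disjoint_family_on_def intro!: sets_coin_agree\<close>)
  also have "\<dots> \<le> 1" by simp
  finally show ?thesis
    by (simp add: cyl_eq_agree measure_def emeasure_coin_agree)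
qed

lemma sum_le_infsum_ennreal:
  fixes f :: "'a \<Rightarrow> ennreal"
  assumes "finite F" "F \<subseteq> A"
  shows "sum f F \<le> infsum f A"
  using assms by (subst nonneg_infsum_complete) (auto intro: SUP_upper)

lemma infsum_le_ennreal:
  fixes f :: "'a \<Rightarrow> ennreal"
  assumes "\<And>F. finite F \<Longrightarrow> F \<subseteq> A \<Longrightarrow> sum f F \<le> c"
  shows "infsum f A \<le> c"
  using assms by (subst nonneg_infsum_complete) (auto intro: SUP_least)

text \<open>This stands in for a measure concentrated on sequences vanishing outside
  \<open>F\<close>: strings are compared with \<open>y\<close> on \<open>F\<close> only, and each
  such relaxed cylinder has coin measure \<open>1/2\<close> to the number of tested positions.
  Countable subadditivity does the rest.\<close>

lemma cover_mass:
  fixes C :: "bool list set"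
  assumes cover: "\<And>y. \<exists>\<sigma>\<in>C. \<forall>i\<in>F \<inter> {..<length \<sigma>}. y i = \<sigma> ! i"
  shows "1 \<le> (\<Sum>\<^sub>\<infinity>\<sigma>\<in>C. ennreal ((1/2) ^ card (F \<inter> {..<length \<sigma>})))"
proof -
  interpret prob_space coin by (rule prob_space_coin)
  define A where "A \<sigma> = {y. \<forall>i\<in>F \<inter> {..<length \<sigma>}. y i = \<sigma> ! i}" for \<sigma> :: "bool list"
  \<comment> \<open>Enumerates \<open>C\<close> by codes; the condition on \<open>to_nat\<close>
    gives every string a single index, so the series is bounded by the sum over
    \<open>C\<close>.\<close>
  define B where "B n = (if from_nat n \<in> C \<and> to_nat (from_nat n :: bool list) = n then A (from_nat n) else {})" for n
  define w where "w \<sigma> = ennreal ((1/2) ^ card (F \<inter> {..<length \<sigma>}))" for \<sigma> :: "bool list"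
  have A: "A \<sigma> \<in> sets coin" "emeasure coin (A \<sigma>) = w \<sigma>" for \<sigma>
    using sets_coin_agree[of "F \<inter> {..<length \<sigma>}"] emeasure_coin_agree[of "F \<inter> {..<length \<sigma>}"]
    by (simp_all add: A_def w_def)
  have B: "B n \<in> sets coin" for n by (auto simp: B_def A)
  have "(\<Union>n. B n) = UNIV"
  proof -
    have "y \<in> (\<Union>n. B n)" for y
    proof -
      obtain \<sigma> where "\<sigma> \<in> C" "y \<in> A \<sigma>" using cover[of y] by (auto simp: A_def)
      then have "y \<in> B (to_nat \<sigma>)" by (simp add: B_def)
      then show ?thesis by blast
    qed
    then show ?thesis by blast
  qed
  then have "1 = emeasure coin (\<Union>n. B n)"
    using emeasure_space_1 by simp
  also have "\<dots> \<le> (\<Sum>n. emeasure coin (B n))"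
    by (rule emeasure_subadditive_countably) (use B in auto)
  also have "\<dots> \<le> (\<Sum>\<^sub>\<infinity>\<sigma>\<in>C. w \<sigma>)"
  proof (rule suminf_le_const)
    fix n :: nat
    let ?I = "{k\<in>{..<n}. from_nat k \<in> C \<and> to_nat (from_nat k :: bool list) = k}"
    have "(\<Sum>k<n. emeasure coin (B k)) = (\<Sum>k\<in>?I. emeasure coin (B k))"
      by (rule sum.mono_neutral_right) (auto simp: B_def)
    also have "\<dots> = (\<Sum>k\<in>?I. w (from_nat k))"
      by (rule sum.cong) (auto simp: B_def A)
    also have "\<dots> = (\<Sum>\<sigma>\<in>from_nat ` ?I. w \<sigma>)"
      by (subst sum.reindex) (auto intro!: inj_on_inverseI[where g = to_nat])
    also have "\<dots> \<le> (\<Sum>\<^sub>\<infinity>\<sigma>\<in>C. w \<sigma>)"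
      by (rule sum_le_infsum_ennreal) auto
    finally show "(\<Sum>k<n. emeasure coin (B k)) \<le> (\<Sum>\<^sub>\<infinity>\<sigma>\<in>C. w \<sigma>)" .
  qed simp
  finally show ?thesis by (simp add: w_def)
qed

section \<open>Total recursive functions\<close>

text \<open>The equivalence asserts termination and uniqueness of the value together, so the closure
  lemmas yield determinism of \<open>eval\<close> along the way.\<close>

definition computes :: "recf \<Rightarrow> nat \<Rightarrow> (nat list \<Rightarrow> nat) \<Rightarrow> bool" where
  "computes c n F \<longleftrightarrow> (\<forall>xs. length xs = n \<longrightarrow> (\<forall>y. eval c xs y \<longleftrightarrow> y = F xs))"

definition total_rec :: "nat \<Rightarrow> (nat list \<Rightarrow> nat) \<Rightarrow> bool" where
  "total_rec n F \<longleftrightarrow> (\<exists>c. computes c n F)"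

inductive_cases eval_ZeroE: "eval Zero xs y"
inductive_cases eval_SuccE: "eval Succ xs y"
inductive_cases eval_ProjE: "eval (Proj i) xs y"
inductive_cases eval_CompE: "eval (Comp f gs) xs y"
inductive_cases eval_Prim0E: "eval (Prim f g) (0 # xs) y"
inductive_cases eval_PrimSE: "eval (Prim f g) (Suc n # xs) y"
inductive_cases eval_MuE: "eval (Mu f) xs y"

lemma total_rec_zero: "total_rec n (\<lambda>_. 0)"
  unfolding total_rec_def computes_def
  by (rule exI[of _ Zero]) (auto intro: eval_Zero elim: eval_ZeroE)

lemma total_rec_proj: "i < n \<Longrightarrow> total_rec n (\<lambda>xs. xs ! i)"
  unfolding total_rec_def computes_def
  by (rule exI[of _ "Proj i"]) (auto intro: eval_Proj elim: eval_ProjE)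

lemma total_rec_comp:
  assumes "total_rec (length Gs) F" and "\<forall>G\<in>set Gs. total_rec n G"
  shows "total_rec n (\<lambda>xs. F (map (\<lambda>G. G xs) Gs))"
proof -
  obtain f where f: "computes f (length Gs) F" using assms(1) by (auto simp: total_rec_def)
  have "\<exists>gs. list_all2 (\<lambda>g G. computes g n G) gs Gs"
    using assms(2) by (induction Gs) (auto simp: total_rec_def list_all2_Cons2)
  then obtain gs where gs: "list_all2 (\<lambda>g G. computes g n G) gs Gs" ..
  have *: "list_all2 (\<lambda>g y. eval g xs y) gs ys \<longleftrightarrow> ys = map (\<lambda>G. G xs) Gs" if "length xs = n" for xs ys
    using gs
  proof (induction gs Gs arbitrary: ys rule: list_all2_induct)
    case Nil then show ?case by auto
  next
    case (Cons g gs G Gs)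
    then show ?case using that by (cases ys) (auto simp: computes_def)
  qed
  have "computes (Comp f gs) n (\<lambda>xs. F (map (\<lambda>G. G xs) Gs))"
    unfolding computes_def
  proof (intro allI impI)
    fix xs :: "nat list" and y assume l: "length xs = n"
    have "eval (Comp f gs) xs y \<longleftrightarrow> (\<exists>ys. list_all2 (\<lambda>g y. eval g xs y) gs ys \<and> eval f ys y)"
      by (auto intro: eval_Comp elim: eval_CompE)
    also have "\<dots> \<longleftrightarrow> eval f (map (\<lambda>G. G xs) Gs) y"
      using *[OF l] by auto
    also have "\<dots> \<longleftrightarrow> y = F (map (\<lambda>G. G xs) Gs)"
      using f by (simp add: computes_def)
    finally show "eval (Comp f gs) xs y \<longleftrightarrow> y = F (map (\<lambda>G. G xs) Gs)" .
  qed
  then show ?thesis by (auto simp: total_rec_def)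
qed

lemma total_rec_comp1:
  assumes "total_rec 1 (\<lambda>xs. F (xs ! 0))" "total_rec n G"
  shows "total_rec n (\<lambda>xs. F (G xs))"
  using total_rec_comp[of "[G]" "\<lambda>xs. F (xs ! 0)" n] assms by simp

lemma total_rec_comp2:
  assumes "total_rec 2 (\<lambda>xs. F (xs ! 0) (xs ! 1))" "total_rec n G" "total_rec n H"
  shows "total_rec n (\<lambda>xs. F (G xs) (H xs))"
  using total_rec_comp[of "[G, H]" "\<lambda>xs. F (xs ! 0) (xs ! 1)" n] assms by (simp add: numeral_2_eq_2)

lemma total_rec_Suc:
  assumes "total_rec n G"
  shows "total_rec n (\<lambda>xs. Suc (G xs))"
proof (rule total_rec_comp1[OF _ assms])
  show "total_rec 1 (\<lambda>xs. Suc (xs ! 0))"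
    unfolding total_rec_def computes_def
    by (rule exI[of _ Succ]) (auto simp: length_Suc_conv intro: eval_Succ elim: eval_SuccE)
qed

lemma total_rec_const: "total_rec n (\<lambda>_. k)"
  by (induction k) (auto intro: total_rec_zero total_rec_Suc)

lemma total_rec_prim:
  assumes f: "total_rec n F" and g: "total_rec (Suc (Suc n)) G"
    and H0: "\<And>xs. length xs = n \<Longrightarrow> H (0 # xs) = F xs"
    and HS: "\<And>k xs. length xs = n \<Longrightarrow> H (Suc k # xs) = G (H (k # xs) # k # xs)"
  shows "total_rec (Suc n) H"
proof -
  obtain cf cg where c: "computes cf n F" "computes cg (Suc (Suc n)) G"
    using f g by (auto simp: total_rec_def)
  have "eval (Prim cf cg) (k # xs) y \<longleftrightarrow> y = H (k # xs)" if "length xs = n" for k xs y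
  proof (induction k arbitrary: y)
    case 0
    have "eval (Prim cf cg) (0 # xs) y \<longleftrightarrow> eval cf xs y"
      by (auto intro: eval_Prim0 elim: eval_Prim0E)
    then show ?case using c that H0 by (simp add: computes_def)
  next
    case (Suc k)
    have "eval (Prim cf cg) (Suc k # xs) y \<longleftrightarrow>
        (\<exists>r. eval (Prim cf cg) (k # xs) r \<and> eval cg (r # k # xs) y)"
      by (auto intro: eval_PrimS elim: eval_PrimSE)
    then show ?case using c that HS Suc by (simp add: computes_def)
  qed
  then have "computes (Prim cf cg) (Suc n) H"
    by (auto simp: computes_def length_Suc_conv)
  then show ?thesis by (auto simp: total_rec_def)
qed

lemma total_rec_prim2:
  assumes f: "total_rec 1 (\<lambda>xs. F (xs ! 0))" and g: "total_rec 3 (\<lambda>xs. G (xs ! 0) (xs ! 1) (xs ! 2))"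
    and H0: "\<And>x. H 0 x = F x"
    and HS: "\<And>k x. H (Suc k) x = G (H k x) k x"
  shows "total_rec 2 (\<lambda>xs. H (xs ! 0) (xs ! 1))"
  using total_rec_prim[of 1 "\<lambda>xs. F (xs ! 0)" "\<lambda>xs. G (xs ! 0) (xs ! 1) (xs ! 2)" "\<lambda>xs. H (xs ! 0) (xs ! 1)"]
    assms by (simp add: numeral_2_eq_2 numeral_3_eq_3)

lemma eval_Mu_iff:
  assumes "computes c (Suc n) G" "length xs = n"
  shows "eval (Mu c) xs k \<longleftrightarrow> G (k # xs) = 0 \<and> (\<forall>m<k. G (m # xs) \<noteq> 0)"
proof -
  have "eval (Mu c) xs k \<longleftrightarrow> eval c (k # xs) 0 \<and> (\<forall>m<k. \<exists>j. eval c (m # xs) (Suc j))"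
    by (auto intro: eval_Mu elim: eval_MuE)
  moreover have "(\<exists>j. eval c (m # xs) (Suc j)) \<longleftrightarrow> G (m # xs) \<noteq> 0" "eval c (m # xs) 0 \<longleftrightarrow> G (m # xs) = 0" for m
    using assms not0_implies_Suc[of "G (m # xs)"] by (auto simp: computes_def)
  ultimately show ?thesis by simp
qed

lemma total_rec_mu:
  assumes "total_rec (Suc n) G"
    and H: "\<And>xs. length xs = n \<Longrightarrow> G (H xs # xs) = 0"
      "\<And>xs m. length xs = n \<Longrightarrow> m < H xs \<Longrightarrow> G (m # xs) \<noteq> 0"
  shows "total_rec n H"
proof -
  obtain c where c: "computes c (Suc n) G" using assms(1) by (auto simp: total_rec_def)
  have "computes (Mu c) n H"
    unfolding computes_def
    using eval_Mu_iff[OF c] H by (metis linorder_neqE_nat)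
  then show ?thesis by (auto simp: total_rec_def)
qed

section \<open>Arithmetic by primitive recursion and search\<close>

lemma total_rec_add:
  assumes "total_rec n G" "total_rec n H"
  shows "total_rec n (\<lambda>xs. G xs + H xs)"
  by (rule total_rec_comp2[OF total_rec_prim2[where F = "\<lambda>x. x" and G = "\<lambda>r k x. Suc r"] assms])
     (auto intro!: total_rec_Suc total_rec_proj)

lemma total_rec_mult:
  assumes "total_rec n G" "total_rec n H"
  shows "total_rec n (\<lambda>xs. G xs * H xs)"
  by (rule total_rec_comp2[OF total_rec_prim2[where F = "\<lambda>x. 0" and G = "\<lambda>r k x. x + r"] assms])
     (auto intro!: total_rec_add total_rec_proj total_rec_zero)

lemma total_rec_pred:
  assumes "total_rec n G"
  shows "total_rec n (\<lambda>xs. G xs - 1)"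
proof -
  have "total_rec 2 (\<lambda>xs. (\<lambda>k _. k - 1) (xs ! 0) (xs ! 1))"
    by (rule total_rec_prim2[where F = "\<lambda>x. 0" and G = "\<lambda>r k x. k"])
       (auto intro!: total_rec_proj total_rec_zero)
  from total_rec_comp2[OF this assms assms] show ?thesis by simp
qed

lemma total_rec_diff:
  assumes "total_rec n G" "total_rec n H"
  shows "total_rec n (\<lambda>xs. G xs - H xs)"
proof -
  \<comment> \<open>The recursion runs on the subtrahend and iterates the predecessor, hence the
    swapped arguments here and in the final composition.\<close>
  have "total_rec 2 (\<lambda>xs. (\<lambda>k x. x - k) (xs ! 0) (xs ! 1))"
    by (rule total_rec_prim2[where F = "\<lambda>x. x" and G = "\<lambda>r k x. r - 1"])
       (auto intro!: total_rec_proj total_rec_pred[unfolded One_nat_def])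
  from total_rec_comp2[OF this assms(2,1)] show ?thesis by simp
qed

lemma total_rec_pow2:
  assumes "total_rec n G"
  shows "total_rec n (\<lambda>xs. 2 ^ G xs)"
proof -
  have "total_rec 2 (\<lambda>xs. (\<lambda>k _. 2 ^ k) (xs ! 0) (xs ! 1))"
    by (rule total_rec_prim2[where F = "\<lambda>x. 1" and G = "\<lambda>r k x. 2 * r"])
       (auto intro!: total_rec_proj total_rec_mult total_rec_const)
  from total_rec_comp2[OF this assms assms] show ?thesis by simp
qed

text \<open>The quotient is the least \<open>q\<close> with \<open>x < Suc d * Suc q\<close>;
  truncated subtraction makes this a zero test, and the successor in the divisor keeps the search
  total.\<close>

lemma total_rec_div:
  assumes "total_rec n G" "total_rec n H"
  shows "total_rec n (\<lambda>xs. G xs div Suc (H xs))"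
proof -
  have "total_rec 2 (\<lambda>xs. (\<lambda>x d. x div Suc d) (xs ! 0) (xs ! 1))"
  proof (rule total_rec_mu)
    show "total_rec (Suc 2) (\<lambda>xs. Suc (xs ! 1) - Suc (xs ! 2) * Suc (xs ! 0))"
      by (intro total_rec_diff total_rec_mult total_rec_Suc total_rec_proj) auto
  next
    fix xs :: "nat list"
    show "Suc ((((xs ! 0) div Suc (xs ! 1)) # xs) ! 1) - Suc ((((xs ! 0) div Suc (xs ! 1)) # xs) ! 2) * Suc ((((xs ! 0) div Suc (xs ! 1)) # xs) ! 0) = 0"
      using dividend_less_times_div[of "Suc (xs ! 1)" "xs ! 0"] by (simp add: numeral_2_eq_2)
  next
    fix xs :: "nat list" and m assume "m < xs ! 0 div Suc (xs ! 1)"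
    then have "Suc m * Suc (xs ! 1) \<le> xs ! 0"
      by (metis Suc_leI less_eq_div_iff_mult_less_eq zero_less_Suc)
    then show "Suc ((m # xs) ! 1) - Suc ((m # xs) ! 2) * Suc ((m # xs) ! 0) \<noteq> 0"
      by (simp add: numeral_2_eq_2 algebra_simps)
  qed
  from total_rec_comp2[OF this assms] show ?thesis .
qed

section \<open>A machine that appends zeros\<close>

lemma enc_append: "enc (xs @ ys) = enc xs + 2 ^ length xs * enc ys"
  by (induction xs) (auto simp: algebra_simps)

lemma Suc_enc_replicate_False: "Suc (enc (replicate k False)) = 2 ^ k"
  by (induction k) auto

lemma enc_replicate_True: "enc (replicate k True) + 2 = 2 * 2 ^ k"
  by (induction k) auto

text \<open>\<open>Suc (enc xs)\<close> is the number whose binary digits, least significant first,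
  are \<open>xs\<close> followed by a leading 1. Its size therefore determines the length.\<close>

lemma Suc_enc_bounds: "2 ^ length xs \<le> Suc (enc xs)" "Suc (enc xs) < 2 ^ Suc (length xs)"
  by (induction xs) auto

lemma inj_enc: "inj enc"
proof (rule injI)
  fix xs ys show "enc xs = enc ys \<Longrightarrow> xs = ys"
  proof (induction xs arbitrary: ys)
    case Nil
    then show ?case by (cases ys) (auto split: if_splits)
  next
    case (Cons b xs)
    then obtain c ys' where ys: "ys = c # ys'" by (cases ys) (auto split: if_splits)
    have "b = c \<and> enc xs = enc ys'"
      using Cons.prems unfolding ys by (simp split: if_splits) presburger+
    with Cons.IH ys show ?case by simp
  qed
qed

lemma surj_enc: "\<exists>xs. enc xs = n"
proof (induction n rule: less_induct)
  case (less n)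
  show ?case
  proof (cases "n = 0")
    case True then show ?thesis by (intro exI[of _ "[]"]) simp
  next
    case False
    then have "(n - 1) div 2 < n" by linarith
    then obtain xs where xs: "enc xs = (n - 1) div 2" using less by blast
    have "enc (even n # xs) = n" using False by (simp add: xs) presburger
    then show ?thesis by blast
  qed
qed

text \<open>Appending zeros only moves the leading 1 from position \<open>length \<tau>\<close> to
  \<open>length \<tau> + k\<close>. The additive form avoids truncated subtraction.\<close>

lemma enc_append_zeros: "Suc (enc (\<tau> @ replicate k False)) + 2 ^ length \<tau> = Suc (enc \<tau>) + 2 ^ (length \<tau> + k)"
proof -
  have "2 ^ length \<tau> * Suc (enc (replicate k False)) = 2 ^ (length \<tau> + k)"
    by (simp only: Suc_enc_replicate_False power_add)
  then show ?thesis by (simp add: enc_append)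
qed

text \<open>Adding 1 to the numeral \<open>Suc (enc p)\<close> carries through the \<open>j\<close>
  ones into the zero. So \<open>j\<close> becomes a 2-adic valuation and \<open>\<tau>\<close> is
  read off the odd part.\<close>

lemma enc_unary_prefix: "enc (replicate j True @ False # \<tau>) + 2 = 2 ^ j * (2 * Suc (enc \<tau>) + 1)"
  using enc_replicate_True[of j] by (simp add: enc_append algebra_simps)

text \<open>The 2-adic valuation, for positive arguments.\<close>

definition val2 :: "nat \<Rightarrow> nat" where
  "val2 n = (LEAST j. odd (n div 2 ^ j))"

lemma val2_eq: "val2 (2 ^ j * (2 * t + 1)) = j"
  unfolding val2_def
proof (rule Least_equality)
  fix i assume *: "odd ((2 ^ j * (2 * t + 1)) div 2 ^ i :: nat)"
  show "j \<le> i"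
  proof (rule ccontr)
    assume "\<not> j \<le> i"
    then obtain k where "j = i + Suc k" using less_imp_Suc_add[of i j] by auto
    then have "(2 ^ j * (2 * t + 1)) div 2 ^ i = 2 * (2 ^ k * (2 * t + 1))"
      by (simp add: power_add)
    with * show False by simp
  qed
qed simp

lemma odd_part_exists: "n > 0 \<Longrightarrow> \<exists>j t. n = 2 ^ j * (2 * t + 1)" for n :: nat
proof (induction n rule: less_induct)
  case (less n)
  show ?case
  proof (cases "even n")
    case False
    then obtain t where "n = 2 ^ 0 * (2 * t + 1)" by (auto elim: oddE)
    then show ?thesis by blast
  next
    case True
    then obtain m where m: "n = 2 * m" by (auto elim: evenE)
    with less obtain j t where "m = 2 ^ j * (2 * t + 1)" by (metis mult_2 less_add_same_cancel1 nat_0_less_mult_iff)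
    then have "n = 2 ^ Suc j * (2 * t + 1)" using m by simp
    then show ?thesis by blast
  qed
qed

lemma odd_val2: "n > 0 \<Longrightarrow> odd (n div 2 ^ val2 n)"
  using odd_part_exists[of n] val2_eq by force

lemma total_rec_val2:
  assumes "total_rec n G"
  shows "total_rec n (\<lambda>xs. val2 (G xs + 2))"
proof -
  \<comment> \<open>The divisor \<open>2 ^ j\<close> is written as a successor to fit
    \<open>total_rec_div\<close>.\<close>
  define D where "D j x = (x + 2) div Suc (2 ^ j - 1)" for j x :: nat
  have D: "D j x = (x + 2) div 2 ^ j" for j x by (simp add: D_def)
  have "total_rec 1 (\<lambda>xs. val2 (xs ! 0 + 2))"
  proof (rule total_rec_mu)
    \<comment> \<open>The inner difference is \<open>D mod 2\<close>, so the expression is zero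
      exactly when the shifted number is odd.\<close>
    show "total_rec (Suc 1) (\<lambda>xs. 1 - (D (xs ! 0) (xs ! 1) - 2 * (D (xs ! 0) (xs ! 1) div Suc 1)))"
      unfolding D_def
      by (intro total_rec_diff total_rec_mult total_rec_add total_rec_div total_rec_pow2
          total_rec_const total_rec_proj) auto
  next
    fix xs :: "nat list"
    have "odd (D (val2 (xs ! 0 + 2)) (xs ! 0))"
      unfolding D by (rule odd_val2) simp
    then show "1 - (D ((val2 (xs ! 0 + 2) # xs) ! 0) ((val2 (xs ! 0 + 2) # xs) ! 1) -
       2 * (D ((val2 (xs ! 0 + 2) # xs) ! 0) ((val2 (xs ! 0 + 2) # xs) ! 1) div Suc 1)) = 0"
      by (simp add: numeral_2_eq_2[symmetric] minus_mult_div_eq_mod odd_iff_mod_2_eq_one)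
  next
    fix xs :: "nat list" and m assume "m < val2 (xs ! 0 + 2)"
    then have "even (D m (xs ! 0))"
      unfolding D val2_def using not_less_Least by blast
    then show "1 - (D ((m # xs) ! 0) ((m # xs) ! 1) - 2 * (D ((m # xs) ! 0) ((m # xs) ! 1) div Suc 1)) \<noteq> 0"
      by (simp add: numeral_2_eq_2[symmetric])
  qed
  from total_rec_comp1[OF this assms] show ?thesis .
qed

text \<open>
  The machine maps \<open>1\<^sup>j 0 \<tau>\<close> with \<open>|\<tau>| = a j\<close> to \<open>\<tau>\<close> padded with zeros to length \<open>b j\<close>. The unary length
  information costs only the fraction \<open>1/b\<close> of the output length, so no efficient coding of numbers is needed.
  For \<open>a = b = 1\<close> every string is an output, so complexities are finite.
\<close>

definition pad_machine :: "nat \<Rightarrow> nat \<Rightarrow> machine" where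
  "pad_machine a b p =
     (let j = length (takeWhile id p); \<tau> = drop (Suc j) p
      in if j < length p \<and> length \<tau> = a * j then Some (\<tau> @ replicate ((b - a) * j) False) else None)"

lemma pad_machine_eq_Some:
  "pad_machine a b p = Some y \<longleftrightarrow>
     (\<exists>j \<tau>. p = replicate j True @ False # \<tau> \<and> length \<tau> = a * j \<and> y = \<tau> @ replicate ((b - a) * j) False)"
  (is "?L \<longleftrightarrow> ?R")
proof
  assume ?R
  then obtain j \<tau> where p: "p = replicate j True @ False # \<tau>"
    and "length \<tau> = a * j" "y = \<tau> @ replicate ((b - a) * j) False" by blast
  moreover have "takeWhile id p = replicate j True"
    unfolding p by (subst takeWhile_append2) auto
  ultimately show ?L by (simp add: pad_machine_def Let_def)
next
  assume L: ?L
  define j where "j = length (takeWhile id p)"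
  have j: "j < length p" "length (drop (Suc j) p) = a * j"
      "y = drop (Suc j) p @ replicate ((b - a) * j) False"
    using L unfolding pad_machine_def Let_def j_def by (auto split: if_splits)
  have "takeWhile id p = replicate j True"
    unfolding j_def by (rule replicate_eqI) (auto dest: set_takeWhileD)
  moreover have "dropWhile id p = False # drop (Suc j) p"
  proof -
    have "dropWhile id p = drop j p" unfolding j_def by (rule dropWhile_eq_drop)
    also have "\<dots> = p ! j # drop (Suc j) p" using j(1) by (rule Cons_nth_drop_Suc[symmetric])
    also have "p ! j = False" using nth_length_takeWhile[of id p] j(1) unfolding j_def by simp
    finally show ?thesis .
  qed
  ultimately have "p = replicate j True @ False # drop (Suc j) p"
    using takeWhile_dropWhile_id[of id p] by metis
  with j show ?R by blast
qed

text \<open>Here \<open>t\<close> is \<open>Suc (enc \<tau>)\<close>: the two bounds on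
  \<open>t\<close> say that \<open>\<tau>\<close> has length \<open>a * j\<close>, and the last
  equation moves the leading 1 up to position \<open>b * j\<close>.\<close>

lemma pad_machine_iff_enc:
  assumes "a \<le> b"
  shows "pad_machine a b p = Some y \<longleftrightarrow>
    (\<exists>j t. enc p + 2 = 2 ^ j * (2 * t + 1) \<and> 2 ^ (a * j) \<le> t \<and> t < 2 ^ Suc (a * j) \<and>
       Suc (enc y) + 2 ^ (a * j) = t + 2 ^ (b * j))" (is "_ \<longleftrightarrow> ?R")
proof
  have len: "a * j + (b - a) * j = b * j" for j
    using assms by (metis add_mult_distrib le_add_diff_inverse)
  {
    assume "pad_machine a b p = Some y"
    then obtain j \<tau> where p: "p = replicate j True @ False # \<tau>"
      and \<tau>: "length \<tau> = a * j" and y: "y = \<tau> @ replicate ((b - a) * j) False"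
      by (auto simp: pad_machine_eq_Some)
    show ?R
      using enc_unary_prefix[of j \<tau>] enc_append_zeros[of \<tau> "(b - a) * j"] Suc_enc_bounds[of \<tau>]
      unfolding p y \<tau> len by blast
  next
    assume ?R
    then obtain j t where p: "enc p + 2 = 2 ^ j * (2 * t + 1)" and t: "2 ^ (a * j) \<le> t" "t < 2 ^ Suc (a * j)"
      and y: "Suc (enc y) + 2 ^ (a * j) = t + 2 ^ (b * j)" by blast
    obtain \<tau> where \<tau>: "enc \<tau> = t - 1" using surj_enc by blast
    have "t > 0" using t(1) by (metis gr0I le_zero_eq power_not_zero zero_neq_numeral)
    then have t': "t = Suc (enc \<tau>)" using \<tau> by simp
    have "(2::nat) ^ length \<tau> < 2 ^ Suc (a * j)" "(2::nat) ^ (a * j) < 2 ^ Suc (length \<tau>)"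
      using Suc_enc_bounds[of \<tau>] t unfolding t' by (meson le_less_trans)+
    then have "length \<tau> < Suc (a * j)" "a * j < Suc (length \<tau>)"
      by (meson power_less_imp_less_exp one_less_numeral_iff semiring_norm(76))+
    then have l: "length \<tau> = a * j" by simp
    have "enc p = enc (replicate j True @ False # \<tau>)"
      using p enc_unary_prefix[of j \<tau>] unfolding t' by simp
    moreover have "enc y = enc (\<tau> @ replicate ((b - a) * j) False)"
      using y enc_append_zeros[of \<tau> "(b - a) * j"] unfolding t' l len by simp
    ultimately show "pad_machine a b p = Some y"
      using l inj_enc by (auto simp: pad_machine_eq_Some dest: injD)
  }
qed

text \<open>The graph of the machine is decidable by arithmetic, so the output is found by unbounded
  search, which diverges exactly when there is none.\<close>

lemma computable_pad_machine:
  assumes "a \<le> b"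
  shows "computable_machine (pad_machine a b)"
proof -
  define J where "J x = val2 (x + 2)" for x
  define T where "T x = (x + 2) div Suc (2 ^ J x - 1) div Suc 1" for x
  \<comment> \<open>A sum of truncated differences vanishes iff each does: two for the bounds, two
    for the halves of the equation.\<close>
  define G where "G z x = (2 ^ (a * J x) - T x) + (Suc (T x) - 2 ^ Suc (a * J x))
     + ((Suc z + 2 ^ (a * J x)) - (T x + 2 ^ (b * J x))) + ((T x + 2 ^ (b * J x)) - (Suc z + 2 ^ (a * J x)))" for z x
  have "total_rec (Suc 1) (\<lambda>xs. G (xs ! 0) (xs ! 1))"
    unfolding G_def T_def J_def
    by (intro total_rec_diff total_rec_mult total_rec_add total_rec_div total_rec_pow2 total_rec_Suc
        total_rec_const total_rec_proj total_rec_val2) auto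
  then obtain c where c: "computes c (Suc 1) (\<lambda>xs. G (xs ! 0) (xs ! 1))"
    by (auto simp: total_rec_def)
  have G0: "G z x = 0 \<longleftrightarrow> 2 ^ (a * J x) \<le> T x \<and> T x < 2 ^ Suc (a * J x) \<and>
       Suc z + 2 ^ (a * J x) = T x + 2 ^ (b * J x)" for z x
    by (auto simp: G_def)
  \<comment> \<open>Valuation and odd part are unique, so \<open>J\<close> and \<open>T\<close>
    recover \<open>j\<close> and \<open>t\<close> from the program code alone.\<close>
  have dec: "x + 2 = 2 ^ j * (2 * t + 1) \<longleftrightarrow> j = J x \<and> t = T x" for x j t
  proof -
    have *: "j = J x \<and> t = T x" if "x + 2 = 2 ^ j * (2 * t + 1)" for j t
      using that val2_eq[of j t] unfolding J_def T_def by (simp add: numeral_2_eq_2[symmetric])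
    moreover obtain j' t' where "x + 2 = 2 ^ j' * (2 * t' + 1)"
      using odd_part_exists[of "x + 2"] by auto
    ultimately show ?thesis by metis
  qed
  \<comment> \<open>The equation determines \<open>z\<close> from \<open>x\<close>, so the search
    cannot stop before the correct output.\<close>
  have uniq: "G m x \<noteq> 0" if "G z x = 0" "m < z" for m z x
    using that by (auto simp: G0)
  have "pad_machine a b p = Some y \<longleftrightarrow> eval (Mu c) [enc p] (enc y)" for p y
  proof -
    have "pad_machine a b p = Some y \<longleftrightarrow> G (enc y) (enc p) = 0"
      unfolding pad_machine_iff_enc[OF assms] dec G0 by auto
    then show ?thesis using eval_Mu_iff[OF c, of "[enc p]" "enc y"] uniq by auto
  qed
  then show ?thesis unfolding computable_machine_def by blast
qed

text \<open>The unary header determines \<open>j\<close>, and \<open>j\<close> determines the length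
  of the program; a prefix with the same header is the whole program.\<close>

lemma prefix_free_pad_machine:
  assumes "a \<le> b"
  shows "prefix_free_machine (pad_machine a b)"
  unfolding prefix_free_machine_def
proof (intro conjI allI impI)
  fix p q assume "pad_machine a b p \<noteq> None" "pad_machine a b q \<noteq> None" and t: "take (length p) q = p"
  then obtain j \<tau> i \<rho> where p: "p = replicate j True @ False # \<tau>" "length \<tau> = a * j"
    and q: "q = replicate i True @ False # \<rho>" "length \<rho> = a * i"
    using pad_machine_eq_Some by (metis option.exhaust)
  obtain r where r: "q = p @ r" using t by (metis append_take_drop_id)
  have "takeWhile id q = replicate j True" unfolding r p by (simp add: takeWhile_append)
  moreover have "takeWhile id q = replicate i True" unfolding q by (simp add: takeWhile_append)
  ultimately have "i = j" by (metis length_replicate)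
  then have "length p = length q" using p q by simp
  with r show "p = q" by simp
qed (rule computable_pad_machine[OF assms])

section \<open>Complexity bounds for optimal machines\<close>

lemma KM_pad_machine:
  assumes "length \<tau> = a * j"
  shows "KM (pad_machine a b) (\<tau> @ replicate ((b - a) * j) False) \<le> enat (Suc a * j + 1)"
proof -
  have "pad_machine a b (replicate j True @ False # \<tau>) = Some (\<tau> @ replicate ((b - a) * j) False)"
    using assms by (auto simp: pad_machine_eq_Some)
  then show ?thesis unfolding KM_def
    by (rule INF_lower2[OF CollectI]) (simp add: assms)
qed

lemma optimal_pad_bound:
  assumes "optimal_machine U" "a \<le> b"
  obtains c where "\<And>\<tau> j. length \<tau> = a * j \<Longrightarrow>
    KM U (\<tau> @ replicate ((b - a) * j) False) \<le> enat (Suc a * j + c)"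
proof -
  obtain c where c: "\<And>\<sigma>. KM U \<sigma> \<le> KM (pad_machine a b) \<sigma> + enat c"
    using assms prefix_free_pad_machine unfolding optimal_machine_def by blast
  have "KM U (\<tau> @ replicate ((b - a) * j) False) \<le> enat (Suc a * j + (1 + c))" if "length \<tau> = a * j" for \<tau> j
  proof -
    have "KM U (\<tau> @ replicate ((b - a) * j) False) \<le> KM (pad_machine a b) (\<tau> @ replicate ((b - a) * j) False) + enat c"
      by (rule c)
    also have "\<dots> \<le> enat (Suc a * j + 1) + enat c"
      by (intro add_right_mono KM_pad_machine that)
    finally show ?thesis by (simp add: add.assoc)
  qed
  then show thesis by (rule that)
qed

text \<open>Needed for \<open>Kc\<close> to be the actual complexity, as \<open>the_enat\<close>
  says nothing at infinity.\<close>

lemma KM_optimal_finite: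
  assumes "optimal_machine U"
  shows "KM U \<sigma> \<noteq> \<infinity>"
proof -
  obtain c where "\<And>\<tau> j. length \<tau> = 1 * j \<Longrightarrow> KM U (\<tau> @ replicate ((1 - 1) * j) False) \<le> enat (Suc 1 * j + c)"
    using optimal_pad_bound[OF assms order_refl] by metis
  from this[of \<sigma> "length \<sigma>"] show ?thesis by (cases "KM U \<sigma>") auto
qed

lemma Kc_le:
  assumes "KM U \<sigma> \<le> enat n"
  shows "Kc U \<sigma> \<le> real n"
  using assms by (cases "KM U \<sigma>") (auto simp: Kc_def)

lemma shortest_program:
  assumes "optimal_machine U"
  obtains p where "U p = Some \<sigma>" "Kc U \<sigma> = real (length p)"
proof -
  let ?S = "(\<lambda>p. enat (length p)) ` {p. U p = Some \<sigma>}"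
  have "?S \<noteq> {}"
  proof
    assume "?S = {}"
    then have "KM U \<sigma> = \<infinity>" unfolding KM_def by (simp only: Inf_empty top_enat_def)
    with KM_optimal_finite[OF assms] show False by blast
  qed
  then have "Inf ?S \<in> ?S" by (metis ex_in_conv wellorder_InfI)
  then obtain p where "U p = Some \<sigma>" "KM U \<sigma> = enat (length p)"
    unfolding KM_def by auto
  then show thesis using that by (simp add: Kc_def)
qed

section \<open>Upper bound for the Hausdorff measure\<close>

text \<open>Shortest programs of distinct strings are distinct and form a prefix-free set.\<close>

lemma kraft_Kc:
  assumes "optimal_machine U" "finite F"
  shows "(\<Sum>\<sigma>\<in>F. 2 powr (- Kc U \<sigma>)) \<le> 1"
proof -
  have "\<exists>p. U p = Some \<sigma> \<and> Kc U \<sigma> = real (length p)" for \<sigma>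
    using shortest_program[OF assms(1)] by metis
  then obtain pr where pr: "\<And>\<sigma>. U (pr \<sigma>) = Some \<sigma>" "\<And>\<sigma>. Kc U \<sigma> = real (length (pr \<sigma>))"
    by metis
  have inj: "inj_on pr F" by (rule inj_onI) (metis pr(1) option.inject)
  have "(\<Sum>\<sigma>\<in>F. 2 powr (- Kc U \<sigma>)) = (\<Sum>\<sigma>\<in>F. (1/2) ^ length (pr \<sigma>))"
    by (simp add: pr(2) powr_minus powr_realpow power_divide inverse_eq_divide)
  also have "\<dots> = (\<Sum>p\<in>pr ` F. (1/2) ^ length p)"
    using inj by (simp add: sum.reindex)
  also have "\<dots> \<le> 1"
  proof (rule kraft_finite)
    fix p q assume "p \<in> pr ` F" "q \<in> pr ` F" "take (length p) q = p"
    then show "p = q"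
      using assms(1) pr(1) unfolding optimal_machine_def prefix_free_machine_def by auto
  qed (use assms in simp)
  finally show ?thesis .
qed

lemma length_restr [simp]: "length (restr x n) = n"
  by (simp add: restr_def)

lemma restr_nth [simp]: "i < n \<Longrightarrow> restr x n ! i = x i"
  by (simp add: restr_def)

lemma in_cyl_restr: "x \<in> cyl (restr x n)"
  by (simp add: cyl_def)

lemma two_powr_eventually_less:
  assumes "0 < c" "0 < e"
  obtains N :: nat where "\<And>k. N \<le> k \<Longrightarrow> 2 powr (- (c * real k)) < e"
proof -
  obtain N :: nat where N: "- log 2 e / c < N" using reals_Archimedean2 by blast
  have "2 powr (- (c * real k)) < e" if "N \<le> k" for k
  proof -
    have "- log 2 e / c < real k" using N that by linarith
    then have "- (c * real k) < log 2 e" using assms by (simp add: field_simps)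
    then show ?thesis using assms less_log_iff[of 2 e "- (c * real k)"] by simp
  qed
  then show thesis by (rule that)
qed

lemma hausdorff_mono: "A \<subseteq> B \<Longrightarrow> hausdorff f A \<le> hausdorff f B"
  unfolding hausdorff_def by (intro SUP_mono' INF_superset_mono) auto

text \<open>For strings with complexity at most \<open>q\<close> times the length,
  \<open>2 powr (- (r * length \<sigma>))\<close> splits into a small factor and one of size at most
  \<open>2 powr (- Kc U \<sigma>)\<close>, which is summable.\<close>

lemma hausdorff_Dim_le_eq_0:
  assumes U: "optimal_machine U" and "le_star f (\<lambda>x. x powr r)" and "s < r"
  shows "hausdorff f (Dim_le U s) = 0"
proof -
  obtain \<delta> where \<delta>: "\<delta> > 0" "\<And>x. 0 < x \<Longrightarrow> x < \<delta> \<Longrightarrow> f x \<le> x powr r"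
    using assms(2) by (auto simp: le_star_def)
  define q where "q = (s + r) / 2"
  have q: "s < q" "q < r" using assms(3) by (auto simp: q_def)
  have "(INF C \<in> {C. (\<forall>\<sigma>\<in>C. n \<le> length \<sigma>) \<and> Dim_le U s \<subseteq> (\<Union>\<sigma>\<in>C. cyl \<sigma>)}.
      (\<Sum>\<^sub>\<infinity>\<sigma>\<in>C. ennreal (f (2 powr (- real (length \<sigma>)))))) \<le> 0" (is "?I \<le> 0") for n
  proof (rule ennreal_le_epsilon)
    fix e :: real assume "0 < e"
    obtain N1 :: nat where N1: "\<And>k. N1 \<le> k \<Longrightarrow> 2 powr (- (1 * real k)) < \<delta>"
      using two_powr_eventually_less[of 1 \<delta>] \<delta> by auto
    obtain N2 :: nat where N2: "\<And>k. N2 \<le> k \<Longrightarrow> 2 powr (- ((r - q) * real k)) < e"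
      using two_powr_eventually_less[of "r - q" e] q \<open>0 < e\<close> by auto
    \<comment> \<open>\<open>N1\<close> makes the bound on \<open>f\<close> applicable,
      \<open>N2\<close> makes the small factor less than \<open>e\<close>, and \<open>Suc\<close>
      keeps lengths positive for division.\<close>
    define N where "N = Suc (max n (max N1 N2))"
    define C where "C = {\<sigma>. N \<le> length \<sigma> \<and> Kc U \<sigma> \<le> q * length \<sigma>}"
    have "x \<in> (\<Union>\<sigma>\<in>C. cyl \<sigma>)" if "x \<in> Dim_le U s" for x
    proof -
      \<comment> \<open>Dimension at most \<open>s < q\<close> yields arbitrarily long prefixes of
        complexity rate below \<open>q\<close>.\<close>
      have "\<not> (\<forall>\<^sub>F k in sequentially. ereal q \<le> ereal (Kc U (restr x k) / real k))"
      proof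
        assume "\<forall>\<^sub>F k in sequentially. ereal q \<le> ereal (Kc U (restr x k) / real k)"
        then have "ereal q \<le> eff_dim U x" unfolding eff_dim_def by (rule Liminf_bounded)
        also have "\<dots> \<le> ereal s" using that by (simp add: Dim_le_def)
        finally show False using q by simp
      qed
      then obtain k where k: "k \<ge> N" "Kc U (restr x k) / real k < q"
        unfolding eventually_sequentially by (auto simp: not_le)
      have "k > 0" using k(1) by (simp add: N_def)
      then have "restr x k \<in> C" using k by (simp add: C_def field_simps)
      then show ?thesis using in_cyl_restr by blast
    qed
    then have "?I \<le> (\<Sum>\<^sub>\<infinity>\<sigma>\<in>C. ennreal (f (2 powr (- real (length \<sigma>)))))"
      by (intro INF_lower) (auto simp: C_def N_def)
    also have "\<dots> \<le> ennreal e"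
    proof (rule infsum_le_ennreal)
      fix F assume F: "finite F" "F \<subseteq> C"
      have le: "f (2 powr (- real (length \<sigma>))) \<le> e * 2 powr (- Kc U \<sigma>)" if "\<sigma> \<in> F" for \<sigma>
      proof -
        have \<sigma>: "N \<le> length \<sigma>" "Kc U \<sigma> \<le> q * length \<sigma>" using that F by (auto simp: C_def)
        then have NN: "N1 \<le> length \<sigma>" "N2 \<le> length \<sigma>" by (auto simp: N_def)
        have "f (2 powr (- real (length \<sigma>))) \<le> (2 powr (- real (length \<sigma>))) powr r"
          using N1[OF NN(1)] by (intro \<delta>) auto
        also have "\<dots> = 2 powr (- ((r - q) * real (length \<sigma>))) * 2 powr (- (q * length \<sigma>))"
          by (simp add: powr_powr powr_add[symmetric] algebra_simps)
        also have "\<dots> \<le> e * 2 powr (- Kc U \<sigma>)"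
          using N2[of "length \<sigma>", OF NN(2)] \<sigma>(2) \<open>0 < e\<close> by (intro mult_mono) auto
        finally show ?thesis .
      qed
      have "(\<Sum>\<sigma>\<in>F. ennreal (f (2 powr (- real (length \<sigma>))))) \<le> (\<Sum>\<sigma>\<in>F. ennreal (e * 2 powr (- Kc U \<sigma>)))"
        using le by (intro sum_mono ennreal_leI) auto
      also have "\<dots> = ennreal (e * (\<Sum>\<sigma>\<in>F. 2 powr (- Kc U \<sigma>)))"
        using \<open>0 < e\<close> by (subst sum_ennreal) (auto simp: sum_distrib_left)
      also have "\<dots> \<le> ennreal e"
        using kraft_Kc[OF U F(1)] \<open>0 < e\<close> by (intro ennreal_leI) (simp add: mult_left_le)
      finally show "(\<Sum>\<sigma>\<in>F. ennreal (f (2 powr (- real (length \<sigma>))))) \<le> ennreal e" .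
    qed
    finally show "?I \<le> 0 + ennreal e" by simp
  qed
  then show ?thesis unfolding hausdorff_def by (simp add: SUP_le_iff flip: le_zero_eq)
qed

section \<open>Sequences with blocks of zeros\<close>

text \<open>A witness \<open>x\<close> is rounded up to the dyadic point
  \<open>2 powr (- real n)\<close>. Monotonicity of \<open>f\<close> handles the upper end; the
  lower end \<open>2 powr (- real (Suc n)) \<le> x\<close> accounts for \<open>Suc n\<close> in the
  exponent.\<close>

lemma gauge_large_at_dyadic:
  assumes "gauge f" "\<not> le_star f (\<lambda>x. x powr r)" "0 \<le> r"
  obtains n where "N \<le> n" "2 powr (- (r * real (Suc n))) \<le> f (2 powr (- real n))"
proof -
  obtain x where x: "0 < x" "x < 2 powr (- real N)" "x powr r < f x"
    using assms(2) unfolding le_star_def by (metis not_le powr_gt_zero zero_neq_numeral)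
  define n where "n = nat \<lfloor>- log 2 x\<rfloor>"
  have "log 2 x < - real N"
    using x log_less_iff[of 2 x "- real N"] by simp
  then have n: "N \<le> n" "real n \<le> - log 2 x" "- log 2 x < real (Suc n)"
    unfolding n_def by linarith+
  have "2 powr (- real (Suc n)) \<le> 2 powr (log 2 x)" "2 powr (log 2 x) \<le> 2 powr (- real n)"
    using n by (auto simp del: powr_log_cancel)
  then have xn: "2 powr (- real (Suc n)) \<le> x" "x \<le> 2 powr (- real n)" using x by auto
  have "2 powr (- (r * real (Suc n))) = (2 powr (- real (Suc n))) powr r"
    by (simp add: powr_powr algebra_simps)
  also have "\<dots> \<le> x powr r" using xn assms(3) by (intro powr_mono2) auto
  also have "\<dots> \<le> f x" using x by simp
  also have "\<dots> \<le> f (2 powr (- real n))" using assms(1) x xn by (simp add: gauge_def)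
  finally show thesis using that n by blast
qed

text \<open>With \<open>N\<close> the end of the previous zero block, this finds the next one,
  \<open>[m, n)\<close>. The gap \<open>[N, m)\<close> alone must supply enough free positions for
  both the dimension and the gauge bound.\<close>

lemma next_block:
  assumes "gauge f" and large: "\<forall>r. s < r \<and> r \<le> 1 \<longrightarrow> \<not> le_star f (\<lambda>x. x powr r)"
    and s: "0 \<le> s" "s < 1" and \<epsilon>: "0 < \<epsilon>" "\<epsilon> \<le> 1 - s"
  shows "\<exists>m n. N \<le> m \<and> m \<le> n \<and> N < n \<and> real m \<le> (s + \<epsilon>) * real n \<and>
    s * real n \<le> real m - real N \<and> 2 powr (- (real m - real N)) \<le> f (2 powr (- real n))"
proof -
  \<comment> \<open>The other half of \<open>\<epsilon>\<close> is kept to absorb \<open>N\<close>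
    and the rounding.\<close>
  define r where "r = s + \<epsilon> / 2"
  have r: "s < r" "r \<le> 1" "0 \<le> r" using s \<epsilon> by (auto simp: r_def)
  \<comment> \<open>Then \<open>\<epsilon> * n / 2\<close> exceeds \<open>N + 2\<close>, where 2
    pays for \<open>Suc n\<close> in place of \<open>n\<close> and for the ceiling in
    \<open>m\<close>.\<close>
  obtain L :: nat where L: "(2 * N + 4) / \<epsilon> < L" using reals_Archimedean2 by blast
  obtain n where n: "max (Suc N) L \<le> n" "2 powr (- (r * real (Suc n))) \<le> f (2 powr (- real n))"
    using gauge_large_at_dyadic[OF assms(1) _ r(3)] large r by metis
  define m where "m = N + nat \<lceil>r * real (Suc n)\<rceil>"
  have m: "r * real (Suc n) \<le> real m - N" "real m - N \<le> r * real (Suc n) + 1"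
    using r unfolding m_def by (auto simp: of_nat_ceiling)
  have "(2 * N + 4) / \<epsilon> < n" using L n(1) by linarith
  then have "2 * N + 4 < \<epsilon> * n" using \<epsilon> by (simp add: field_simps)
  moreover have "r * real (Suc n) = s * n + \<epsilon> * n / 2 + r" by (simp add: r_def algebra_simps)
  ultimately have mn: "real m \<le> (s + \<epsilon>) * real n"
    using m(2) r(2) by (simp add: algebra_simps)
  moreover have "m \<le> n"
  proof -
    have "(s + \<epsilon>) * real n \<le> 1 * real n" using \<epsilon> by (intro mult_right_mono) auto
    then show ?thesis using mn by linarith
  qed
  moreover have "s * real n \<le> real m - N"
  proof -
    have "s * real n \<le> r * real (Suc n)" using r s by (intro mult_mono) auto
    then show ?thesis using m by linarith
  qed
  moreover have "2 powr (- (real m - real N)) \<le> f (2 powr (- real n))"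
    using n(2) m(1) by (smt (verit) powr_le_cancel_iff)
  moreover have "N \<le> m" by (simp add: m_def)
  ultimately show ?thesis using n(1) by (intro exI[of _ m] exI[of _ n]) auto
qed

text \<open>Positions from \<open>n k\<close> up to \<open>m (Suc k)\<close> are free, those from
  \<open>m (Suc k)\<close> up to \<open>n (Suc k)\<close> are zeros; the block of index 0 is empty.
  \<open>m_upper\<close> drives the dimension down to \<open>s\<close>, \<open>m_lower\<close> keeps
  it from falling below.\<close>

locale blocks =
  fixes m n :: "nat \<Rightarrow> nat" and s :: real
  assumes n_0: "n 0 = 0"
    and n_le_m: "n k \<le> m (Suc k)" and m_le_n: "m (Suc k) \<le> n (Suc k)" and n_less: "n k < n (Suc k)"
    and m_upper: "real (m (Suc k)) \<le> (s + (1 - s) / real (Suc k)) * real (n (Suc k))"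
    and m_lower: "s * real (n (Suc k)) \<le> real (m (Suc k)) - real (n k)"
    and s: "0 \<le> s" "s < 1"
begin

definition free :: "nat set" where
  "free = {i. \<forall>k. \<not> (m k \<le> i \<and> i < n k)}"

definition free_count :: "nat \<Rightarrow> nat" where
  "free_count t = card (free \<inter> {..<t})"

section \<open>Counting free positions\<close>

lemma strict_mono_n: "strict_mono n"
  by (simp add: strict_mono_Suc_iff n_less)

lemma n_mono: "j \<le> k \<Longrightarrow> n j \<le> n k"
  by (simp add: strict_mono_less_eq[OF strict_mono_n])

lemma n_ge: "k \<le> n k"
  by (rule strict_mono_imp_increasing[OF strict_mono_n])

lemma gap_free:
  assumes "n k \<le> i" "i < m (Suc k)"
  shows "i \<in> free"
proof -
  have "\<not> (m j \<le> i \<and> i < n j)" for j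
  proof (cases "j \<le> k")
    case True
    then show ?thesis using n_mono[of j k] assms by auto
  next
    case False
    then obtain l where l: "j = Suc l" "k \<le> l" by (cases j) auto
    have "m (Suc k) \<le> m (Suc l)"
    proof (cases "k = l")
      case False
      then have "n (Suc k) \<le> n l" using l by (intro n_mono) auto
      then show ?thesis using m_le_n[of k] n_le_m[of l] by linarith
    qed simp
    then show ?thesis using assms l by auto
  qed
  then show ?thesis by (simp add: free_def)
qed

lemma free_count_mono: "t \<le> u \<Longrightarrow> free_count t \<le> free_count u"
  unfolding free_count_def by (intro card_mono) auto

lemma free_count_gap:
  assumes "n k \<le> t" "t \<le> m (Suc k)"
  shows "free_count (n k) + (t - n k) \<le> free_count t"
proof -
  have "free_count (n k) + (t - n k) = card ((free \<inter> {..<n k}) \<union> {n k..<t})"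
    unfolding free_count_def by (subst card_Un_disjoint) auto
  also have "\<dots> \<le> free_count t"
    unfolding free_count_def using assms by (intro card_mono) (auto intro: gap_free)
  finally show ?thesis .
qed

lemma free_count_block:
  assumes "m (Suc k) \<le> t"
  shows "m (Suc k) - n k \<le> free_count t"
  using free_count_gap[of k "m (Suc k)"] n_le_m[of k] free_count_mono[OF assms] by linarith

text \<open>Inside a zero block no induction hypothesis is provided: there the bounds come from the
  gap just before it. Only gaps build on the value at their left end.\<close>

lemma block_induct [case_names zero gap block]:
  assumes "P 0"
    and "\<And>k t. P (n k) \<Longrightarrow> n k \<le> t \<Longrightarrow> t \<le> m (Suc k) \<Longrightarrow> P t"
    and "\<And>k t. m (Suc k) \<le> t \<Longrightarrow> t \<le> n (Suc k) \<Longrightarrow> P t"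
  shows "P t"
proof -
  have "\<forall>t\<le>n k. P t" for k
  proof (induction k)
    case 0
    then show ?case using assms(1) n_0 by simp
  next
    case (Suc k)
    then show ?case using assms(2,3) by (metis nat_le_linear order_refl)
  qed
  then show ?thesis using n_ge by blast
qed

text \<open>In a gap the count grows with slope 1, at least \<open>s\<close>; at the start of a
  block it already suffices for the end of the block.\<close>

lemma free_count_lower: "s * real t \<le> real (free_count t)"
proof (induction t rule: block_induct)
  case zero
  then show ?case by simp
next
  case (gap k t)
  have "s * real t = s * real (n k) + s * (real t - real (n k))" by (simp add: algebra_simps)
  also have "\<dots> \<le> real (free_count (n k)) + 1 * (real t - real (n k))"
    using gap s by (intro add_mono mult_right_mono) auto
  also have "\<dots> \<le> real (free_count t)"
    using free_count_gap[OF gap(2,3), THEN of_nat_mono, where 'a = real] gap(2) by (simp add: of_nat_diff)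
  finally show ?case .
next
  case (block k t)
  have "s * real t \<le> s * real (n (Suc k))" using block s by (intro mult_left_mono) auto
  then show ?case using m_lower[of k] free_count_block[OF block(1)] n_le_m[of k] by linarith
qed

text \<open>Frostman-type bound. Across a gap the left side shrinks in proportion to the diameter,
  and \<open>f\<close> shrinks no faster by \<open>ratio\<close>; inside a block
  \<open>large\<close> at its end suffices. \<open>K * f 1 \<ge> 1\<close> starts the
  induction.\<close>

lemma free_count_mass:
  assumes f: "gauge f" and ratio: "\<And>x y. 0 < x \<Longrightarrow> x \<le> y \<Longrightarrow> f y / y \<le> f x / x"
    and large: "\<And>k. 2 powr (- (real (m (Suc k)) - real (n k))) \<le> f (2 powr (- real (n (Suc k))))"
    and K: "1 \<le> K" "1 \<le> K * f 1"
  shows "2 powr (- real (free_count t)) \<le> K * f (2 powr (- real t))"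
proof (induction t rule: block_induct)
  case zero
  then show ?case using K by (simp add: free_count_def)
next
  case (gap k t)
  have "2 powr (- real (free_count t)) \<le> 2 powr (- real (free_count (n k))) * 2 powr (real (n k) - real t)"
    using free_count_gap[OF gap(2,3)] gap(2) by (simp add: powr_add[symmetric])
  also have "\<dots> \<le> (K * f (2 powr (- real (n k)))) * 2 powr (real (n k) - real t)"
    using gap by (intro mult_right_mono) auto
  also have "\<dots> = K * (f (2 powr (- real (n k))) / 2 powr (- real (n k))) * 2 powr (- real t)"
    by (simp add: powr_diff powr_minus field_simps)
  also have "\<dots> \<le> K * (f (2 powr (- real t)) / 2 powr (- real t)) * 2 powr (- real t)"
    using gap(2) K by (intro mult_right_mono mult_left_mono ratio) auto
  also have "\<dots> = K * f (2 powr (- real t))" by simp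
  finally show ?case .
next
  case (block k t)
  have "2 powr (- real (free_count t)) \<le> 2 powr (- (real (m (Suc k)) - real (n k)))"
    using free_count_block[OF block(1)] by simp
  also have "\<dots> \<le> f (2 powr (- real (n (Suc k))))" by (rule large)
  also have "\<dots> \<le> f (2 powr (- real t))" using f block unfolding gauge_def by simp
  also have "\<dots> \<le> K * f (2 powr (- real t))"
    using K f mult_right_mono[of 1 K "f (2 powr (- real t))"] unfolding gauge_def by (simp add: less_imp_le)
  finally show ?case .
qed

section \<open>Effective dimension of block sequences\<close>

lemma ex_zero_block:
  fixes a b :: nat
  assumes "s * real b < real a" "0 < b"
  obtains k j where "N \<le> j" "m (Suc k) \<le> a * j" "b * j \<le> n (Suc k)"
proof -
  \<comment> \<open>The slack of \<open>a / b\<close> over \<open>s\<close>, scaled by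
    \<open>b\<close>. Half of \<open>\<eta> * j\<close> absorbs the excess rate
    \<open>\<epsilon>\<close> (small by \<open>k1\<close>), the other half the rounding of
    \<open>n (Suc k)\<close> to a multiple of \<open>b\<close> (by \<open>J\<close>).\<close>
  define \<eta> where "\<eta> = real a - s * real b"
  have \<eta>: "\<eta> > 0" using assms by (simp add: \<eta>_def)
  obtain J :: nat where J: "(2 * s * b + \<eta>) / \<eta> < J" using reals_Archimedean2 by blast
  obtain k1 :: nat where k1: "2 * b / \<eta> < k1" using reals_Archimedean2 by blast
  \<comment> \<open>Since \<open>n (Suc k)\<close> exceeds \<open>k\<close>, the second term forces
    \<open>j\<close> to reach both \<open>N\<close> and \<open>J\<close>.\<close>
  define k where "k = max k1 (b * max N J)"
  define j where "j = n (Suc k) div b"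
  define \<epsilon> where "\<epsilon> = (1 - s) / real (Suc k)"
  have \<epsilon>: "0 \<le> \<epsilon>" "\<epsilon> * b \<le> \<eta> / 2"
  proof -
    show "0 \<le> \<epsilon>" using s by (simp add: \<epsilon>_def)
    have "2 * b / \<eta> < Suc k" using k1 by (simp add: k_def)
    then have "2 * b < \<eta> * Suc k" using \<eta> by (simp add: field_simps)
    moreover have "(1 - s) * (2 * real b) \<le> 1 * (2 * real b)" using s by (intro mult_right_mono) auto
    ultimately have "(1 - s) * (2 * real b) \<le> \<eta> * Suc k" by linarith
    then show "\<epsilon> * b \<le> \<eta> / 2" by (simp add: \<epsilon>_def field_simps)
  qed
  have "b * max N J \<le> n (Suc k)" using n_ge[of "Suc k"] by (simp add: k_def)
  then have j: "max N J \<le> j" unfolding j_def using assms(2) div_le_mono[of "b * max N J" _ b] by simp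
  have "(2 * s * b + \<eta>) / \<eta> < j" using J j by linarith
  then have j2: "2 * s * b + \<eta> < \<eta> * j" using \<eta> by (simp add: field_simps)
  have "n (Suc k) \<le> b * (j + 1)"
    unfolding j_def using dividend_less_times_div[OF assms(2), of "n (Suc k)"] by simp
  then have "real (n (Suc k)) \<le> real b * (real j + 1)"
    by (metis of_nat_1 of_nat_add of_nat_le_iff of_nat_mult)
  then have "(s + \<epsilon>) * real (n (Suc k)) \<le> (s + \<epsilon>) * (real b * (real j + 1))"
    using s \<epsilon> by (intro mult_left_mono) auto
  also have "\<dots> = s * b * j + s * b + (\<epsilon> * b) * j + \<epsilon> * b" by (simp add: algebra_simps)
  also have "\<dots> \<le> s * b * j + s * b + (\<eta> / 2) * j + \<eta> / 2"
    using \<epsilon> by (intro add_mono mult_right_mono) auto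
  also have "\<dots> \<le> s * b * j + \<eta> * j" using j2 by simp
  also have "\<dots> = real (a * j)" by (simp add: \<eta>_def algebra_simps)
  finally have "real (m (Suc k)) \<le> real (a * j)"
    using m_upper[of k] unfolding \<epsilon>_def by linarith
  then have "m (Suc k) \<le> a * j" by (simp only: of_nat_le_iff)
  moreover have "b * j \<le> n (Suc k)" by (simp add: j_def)
  ultimately show thesis using that j by auto
qed

lemma eff_dim_le:
  assumes U: "optimal_machine U" and x: "\<And>i. i \<notin> free \<Longrightarrow> \<not> x i"
  shows "eff_dim U x \<le> ereal s"
proof (rule ccontr)
  assume "\<not> eff_dim U x \<le> ereal s"
  \<comment> \<open>The cap 1 gives \<open>t < 1\<close>, which later ensures
    \<open>a \<le> b\<close>.\<close>
  then have "ereal s < min (eff_dim U x) 1" using s by (simp add: not_le one_ereal_def)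
  then obtain t where t: "s < t" "ereal t < eff_dim U x" "t < 1"
    using ereal_dense2[of "ereal s" "min (eff_dim U x) 1"] by (auto simp: one_ereal_def)
  \<comment> \<open>Of the 3, one pays for rounding \<open>s * b\<close> up to \<open>a\<close>, one
    for the unary header, and one for the constant \<open>c\<close>, at most
    \<open>j\<close>.\<close>
  obtain b :: nat where b: "3 / (t - s) < b" using reals_Archimedean2 by blast
  have b3: "3 < (t - s) * b" using b t by (simp add: field_simps)
  have b0: "0 < b" using b3 by (cases b) auto
  define a where "a = nat \<lfloor>s * b\<rfloor> + 1"
  have "real a = of_int \<lfloor>s * b\<rfloor> + 1" using s by (simp add: a_def)
  then have a: "s * b < a" "real a \<le> s * b + 1" by linarith+
  have "t * b \<le> b" using t mult_right_mono[of t 1 "real b"] by simp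
  then have ab: "a \<le> b" using a b3 by (simp add: algebra_simps)
  obtain c where c: "\<And>\<tau> j. length \<tau> = a * j \<Longrightarrow>
      KM U (\<tau> @ replicate ((b - a) * j) False) \<le> enat (Suc a * j + c)"
    using optimal_pad_bound[OF U ab] by metis
  have "\<forall>\<^sub>F k in sequentially. ereal t < ereal (Kc U (restr x k) / real k)"
    using t(2) unfolding eff_dim_def by (rule less_LiminfD)
  then obtain N where N: "\<And>k. k \<ge> N \<Longrightarrow> t < Kc U (restr x k) / real k"
    by (auto simp: eventually_sequentially)
  obtain k j where j: "N + c + 1 \<le> j" "m (Suc k) \<le> a * j" "b * j \<le> n (Suc k)"
    using ex_zero_block[OF a(1) b0] by metis
  have "a * j \<le> b * j" using ab by simp
  have "restr x (b * j) = restr x (a * j) @ replicate ((b - a) * j) False"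
  proof (rule nth_equalityI)
    show "length (restr x (b * j)) = length (restr x (a * j) @ replicate ((b - a) * j) False)"
      using \<open>a * j \<le> b * j\<close> by (simp add: diff_mult_distrib)
  next
    fix i assume i: "i < length (restr x (b * j))"
    have "\<not> x i" if "a * j \<le> i"
      using that i j by (intro x) (auto simp: free_def intro!: exI[of _ "Suc k"])
    then show "restr x (b * j) ! i = (restr x (a * j) @ replicate ((b - a) * j) False) ! i"
      using i by (auto simp: nth_append diff_mult_distrib)
  qed
  then have "Kc U (restr x (b * j)) \<le> real (Suc a * j + c)"
    using c[of "restr x (a * j)" j] by (intro Kc_le) simp
  also have "\<dots> = (real a + 1) * j + c" by (simp add: algebra_simps)
  also have "\<dots> \<le> (s * b + 2) * j + j"
  proof (rule add_mono)
    show "(real a + 1) * j \<le> (s * b + 2) * j" using a by (intro mult_right_mono) auto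
  qed (use j(1) in simp)
  also have "\<dots> = (s * b + 3) * j" by (simp add: algebra_simps)
  also have "\<dots> \<le> (t * b) * j"
    using b3 by (intro mult_right_mono) (auto simp: algebra_simps)
  finally have K: "Kc U (restr x (b * j)) \<le> t * real (b * j)" by simp
  have "b * j > 0" using b0 j by simp
  with K have "Kc U (restr x (b * j)) / real (b * j) \<le> t" by (simp only: pos_divide_le_eq of_nat_0_less_iff)
  moreover have "N \<le> b * j" using b0 j(1) by (metis add_leE le_trans mult_le_mono1 nat_mult_1 Suc_leI One_nat_def)
  ultimately show False using N[of "b * j"] by linarith
qed

lemma eff_dim_ge:
  assumes "\<And>t. real (free_count t) - 1 \<le> Kc U (restr x t)"
  shows "ereal s \<le> eff_dim U x"
proof -
  have "(\<lambda>k. s - 1 / real k) \<longlonglongrightarrow> s - 0"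
    by (intro tendsto_intros lim_1_over_n)
  then have "(\<lambda>k. ereal (s - 1 / real k)) \<longlonglongrightarrow> ereal s" by simp
  then have "ereal s = liminf (\<lambda>k. ereal (s - 1 / real k))"
    using lim_imp_Liminf[OF sequentially_bot] by metis
  also have "\<dots> \<le> eff_dim U x"
    unfolding eff_dim_def
  proof (rule Liminf_mono)
    have "s - 1 / real k \<le> Kc U (restr x k) / real k" if "k \<ge> 1" for k
    proof -
      have "s - 1 / real k = (s * real k - 1) / real k" using that by (simp add: field_simps)
      also have "\<dots> \<le> Kc U (restr x k) / real k"
        using assms[of k] free_count_lower[of k] by (intro divide_right_mono) auto
      finally show ?thesis .
    qed
    then show "\<forall>\<^sub>F k in sequentially. ereal (s - 1 / real k) \<le> ereal (Kc U (restr x k) / real k)"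
      by (auto simp: eventually_sequentially)
  qed
  finally show ?thesis .
qed

section \<open>Positive measure by mass distribution\<close>

lemma hausdorff_Dim_eq_pos:
  assumes U: "optimal_machine U" and f: "gauge f"
    and ratio: "\<And>x y. 0 < x \<Longrightarrow> x \<le> y \<Longrightarrow> f y / y \<le> f x / x"
    and large: "\<And>k. 2 powr (- (real (m (Suc k)) - real (n k))) \<le> f (2 powr (- real (n (Suc k))))"
  shows "0 < hausdorff f (Dim_eq U s)"
proof -
  define K where "K = max 1 (1 / f 1)"
  have f1: "0 < f 1" using f by (simp add: gauge_def)
  have K: "1 \<le> K" "1 \<le> K * f 1"
    using f1 by (auto simp: K_def field_simps max_def)
  define w where "w \<sigma> = ennreal ((1/2) ^ free_count (length \<sigma>))" for \<sigma> :: "bool list"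
  define h where "h \<sigma> = ennreal (f (2 powr (- real (length \<sigma>))))" for \<sigma> :: "bool list"
  have half: "(1/2) ^ k = 2 powr (- real k)" for k
    by (simp add: powr_minus powr_realpow power_divide inverse_eq_divide)
  \<comment> \<open>The one bit of slack makes the Kraft sum over \<open>B\<close> at most
    \<open>1/2\<close>.\<close>
  define B where "B = {\<sigma>. Kc U \<sigma> < real (free_count (length \<sigma>)) - 1}"
  define E where "E = {x. (\<forall>i. i \<notin> free \<longrightarrow> \<not> x i) \<and> (\<forall>t. restr x t \<notin> B)}"
  have "E \<subseteq> Dim_eq U s"
  proof
    fix x assume "x \<in> E"
    then have x: "\<And>i. i \<notin> free \<Longrightarrow> \<not> x i" "\<And>t. real (free_count t) - 1 \<le> Kc U (restr x t)"
      by (auto simp: E_def B_def not_less)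
    show "x \<in> Dim_eq U s"
      unfolding Dim_eq_def using eff_dim_le[OF U x(1)] eff_dim_ge[OF x(2)] by (auto intro: antisym)
  qed
  have B_mass: "infsum w B \<le> ennreal (1/2)"
  proof (rule infsum_le_ennreal)
    fix F assume F: "finite F" "F \<subseteq> B"
    have "w \<sigma> \<le> ennreal (1/2 * 2 powr (- Kc U \<sigma>))" if "\<sigma> \<in> F" for \<sigma>
    proof -
      have "2 powr (- real (free_count (length \<sigma>))) \<le> 2 powr (-1 + - Kc U \<sigma>)"
        using that F by (auto simp: B_def)
      also have "\<dots> = 1/2 * 2 powr (- Kc U \<sigma>)" by (subst powr_add) (simp add: powr_minus)
      finally show ?thesis unfolding w_def half by (rule ennreal_leI)
    qed
    then have "sum w F \<le> (\<Sum>\<sigma>\<in>F. ennreal (1/2 * 2 powr (- Kc U \<sigma>)))" by (rule sum_mono)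
    also have "\<dots> = ennreal (1/2 * (\<Sum>\<sigma>\<in>F. 2 powr (- Kc U \<sigma>)))"
      by (subst sum_ennreal) (auto simp: sum_distrib_left)
    also have "\<dots> \<le> ennreal (1/2)" using kraft_Kc[OF U F(1)] by (intro ennreal_leI) simp
    finally show "sum w F \<le> ennreal (1/2)" .
  qed
  \<comment> \<open>\<open>C\<close> covers \<open>E\<close> and \<open>B\<close> catches the other
    block sequences, so together they have mass at least 1. \<open>B\<close> has at most
    \<open>1/2\<close>, so \<open>C\<close> keeps \<open>1/2\<close>, and \<open>w\<close> is at
    most \<open>K\<close> times \<open>h\<close>.\<close>
  have lower: "ennreal (1 / (2 * K)) \<le> infsum h C" if C: "E \<subseteq> (\<Union>\<sigma>\<in>C. cyl \<sigma>)" for C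
  proof -
    have "\<exists>\<sigma>\<in>C \<union> B. \<forall>i\<in>free \<inter> {..<length \<sigma>}. y i = \<sigma> ! i" for y
    proof -
      \<comment> \<open>Zeroing \<open>y\<close> off the free positions gives a block sequence;
        strings are tested on free positions only, where \<open>x\<close> and \<open>y\<close>
        agree.\<close>
      define x where "x i \<longleftrightarrow> i \<in> free \<and> y i" for i
      show ?thesis
      proof (cases "x \<in> E")
        case True
        then obtain \<sigma> where "\<sigma> \<in> C" "x \<in> cyl \<sigma>" using C by blast
        then show ?thesis by (intro bexI[of _ \<sigma>]) (auto simp: cyl_def x_def)
      next
        case False
        then obtain t where "restr x t \<in> B" by (auto simp: E_def x_def)
        then show ?thesis by (intro bexI[of _ "restr x t"]) (auto simp: x_def)
      qed
    qed
    then have "1 \<le> infsum w (C \<union> B)"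
      unfolding w_def free_count_def by (rule cover_mass)
    also have "\<dots> \<le> infsum w C + infsum w B"
    proof (rule infsum_le_ennreal)
      fix F assume F: "finite F" "F \<subseteq> C \<union> B"
      have "sum w F = sum w (F \<inter> C) + sum w (F - C)"
        using F(1) by (rule sum.Int_Diff)
      also have "\<dots> \<le> infsum w C + infsum w B"
        using F by (intro add_mono sum_le_infsum_ennreal) auto
      finally show "sum w F \<le> infsum w C + infsum w B" .
    qed
    also have "\<dots> \<le> ennreal K * infsum h C + ennreal (1/2)"
    proof (rule add_mono[OF _ B_mass], rule infsum_le_ennreal)
      fix F assume F: "finite F" "F \<subseteq> C"
      have "w \<sigma> \<le> ennreal K * h \<sigma>" for \<sigma>
      proof -
        have "w \<sigma> \<le> ennreal (K * f (2 powr (- real (length \<sigma>))))"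
          unfolding w_def half using free_count_mass[OF f ratio large K] by (intro ennreal_leI)
        then show ?thesis using K(1) f by (simp add: h_def ennreal_mult gauge_def less_imp_le)
      qed
      then have "sum w F \<le> ennreal K * sum h F"
        unfolding sum_distrib_left by (rule sum_mono)
      also have "\<dots> \<le> ennreal K * infsum h C"
        using F by (intro mult_left_mono sum_le_infsum_ennreal) auto
      finally show "sum w F \<le> ennreal K * infsum h C" .
    qed
    finally have *: "1 \<le> ennreal K * infsum h C + ennreal (1/2)" .
    show ?thesis
    proof (cases "infsum h C")
      case (real v)
      then have "ennreal 1 \<le> ennreal (K * v + 1/2)"
        using * K by (simp add: ennreal_mult ennreal_plus)
      then have "1 \<le> K * v + 1/2" using real K by (subst (asm) ennreal_le_iff) auto
      then have "1 / (2 * K) \<le> v" using K by (simp add: field_simps)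
      then show ?thesis unfolding real by (rule ennreal_leI)
    qed simp
  qed
  \<comment> \<open>\<open>lower\<close> holds for covers by strings of any length, so level 0 of
    the supremum suffices.\<close>
  have "0 < ennreal (1 / (2 * K))" using K by simp
  also have "\<dots> \<le> hausdorff f E"
    unfolding hausdorff_def h_def[symmetric]
    by (rule SUP_upper2[of 0]) (auto intro!: INF_greatest lower)
  also have "\<dots> \<le> hausdorff f (Dim_eq U s)"
    using \<open>E \<subseteq> Dim_eq U s\<close> by (rule hausdorff_mono)
  finally show ?thesis .
qed

end

section \<open>Choice of the blocks and the equivalence\<close>

lemma ex_blocks:
  assumes "gauge f" and large: "\<forall>r. s < r \<and> r \<le> 1 \<longrightarrow> \<not> le_star f (\<lambda>x. x powr r)"
    and s: "0 \<le> s" "s < 1"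
  obtains m n where "blocks m n s"
    "\<And>k. 2 powr (- (real (m (Suc k)) - real (n k))) \<le> f (2 powr (- real (n (Suc k))))"
proof -
  define Q where "Q k N p \<longleftrightarrow> N \<le> fst p \<and> fst p \<le> snd p \<and> N < snd p \<and>
    real (fst p) \<le> (s + (1 - s) / real (Suc k)) * real (snd p) \<and>
    s * real (snd p) \<le> real (fst p) - real N \<and> 2 powr (- (real (fst p) - real N)) \<le> f (2 powr (- real (snd p)))"
    for k N and p :: "nat \<times> nat"
  \<comment> \<open>Pairs are \<open>(m, n)\<close>, starting at \<open>(0, 0)\<close>. The
    tolerance \<open>(1 - s) / real (Suc k)\<close> tends to 0 and stays within the bound
    \<open>1 - s\<close> of \<open>next_block\<close>.\<close>
  have "\<exists>p. \<forall>k. (k = 0 \<longrightarrow> p k = (0, 0)) \<and> Q k (snd (p k)) (p (Suc k))"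
  proof (rule dependent_nat_choice[where P = "\<lambda>k p. k = 0 \<longrightarrow> p = (0, 0)" and Q = "\<lambda>k x y. Q k (snd x) y"])
    fix x :: "nat \<times> nat" and k :: nat
    have "0 < (1 - s) / real (Suc k)" using s by (intro divide_pos_pos) auto
    moreover have "(1 - s) / real (Suc k) \<le> (1 - s) / 1"
      using s by (intro divide_left_mono) auto
    ultimately obtain m n where "Q k (snd x) (m, n)"
      using next_block[OF assms, of "(1 - s) / real (Suc k)" "snd x"]
      unfolding Q_def fst_conv snd_conv div_by_1 by blast
    then show "\<exists>y. (Suc k = 0 \<longrightarrow> y = (0, 0)) \<and> Q k (snd x) y" by blast
  qed auto
  then obtain p where p: "p 0 = (0, 0)" "\<And>k. Q k (snd (p k)) (p (Suc k))" by blast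
  show thesis
  proof (rule that)
    show "blocks (fst \<circ> p) (snd \<circ> p) s"
      using p s unfolding Q_def by unfold_locales auto
  qed (use p in \<open>auto simp: Q_def\<close>)
qed

theorem theorem2:
  fixes U :: machine and f :: "real \<Rightarrow> real" and s :: real
  assumes "optimal_machine U"
    and "gauge f"
    and "\<forall>x y. 0 < x \<longrightarrow> x \<le> y \<longrightarrow> f y / y \<le> f x / x"
    and "0 \<le> s" and "s < 1"
  shows "(hausdorff f (Dim_eq U s) > 0 \<longleftrightarrow> hausdorff f (Dim_le U s) > 0)
       \<and> (hausdorff f (Dim_le U s) > 0 \<longleftrightarrow>
            (\<forall>r. s < r \<and> r \<le> 1 \<longrightarrow> \<not> le_star f (\<lambda>x. x powr r)))"
proof -
  have 12: "hausdorff f (Dim_le U s) > 0" if "hausdorff f (Dim_eq U s) > 0"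
  proof -
    have "Dim_eq U s \<subseteq> Dim_le U s" by (auto simp: Dim_eq_def Dim_le_def)
    from less_le_trans[OF that hausdorff_mono[OF this]] show ?thesis .
  qed
  have 23: "\<not> le_star f (\<lambda>x. x powr r)" if "hausdorff f (Dim_le U s) > 0" "s < r" for r
    using that hausdorff_Dim_le_eq_0[OF assms(1)] by fastforce
  have 31: "hausdorff f (Dim_eq U s) > 0"
    if large: "\<forall>r. s < r \<and> r \<le> 1 \<longrightarrow> \<not> le_star f (\<lambda>x. x powr r)"
  proof -
    obtain m n where "blocks m n s"
      and *: "\<And>k. 2 powr (- (real (m (Suc k)) - real (n k))) \<le> f (2 powr (- real (n (Suc k))))"
      using ex_blocks[OF assms(2) large assms(4,5)] by metis
    interpret blocks m n s by fact
    show ?thesis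
      by (rule hausdorff_Dim_eq_pos[OF assms(1,2) _ *]) (use assms(3) in blast)
  qed
  show ?thesis using 12 23 31 by blast
qed

end
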